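(* Let $\epsilon^*>0$, $\beta=\frac{8}{3}+\epsilon^*$ and $q=\sqrt{\beta n}$. If $n$ is sufficiently large and Breaker plays the $(n,q)$-triangle game according to the strategy described in the context, then at the end of the game no vertex has Maker-degree at least $q/2$, and Breaker wins the game.
   Context: The $(n,q)$-triangle game is played on the complete graph $K_n$ with vertex set $V$, $|V|=n$. In every turn, Maker first claims one previously unclaimed edge and then Breaker claims $q$ previously unclaimed edges; the game ends when all edges are claimed. Maker wins if he claims all three edges of some triangle, otherwise Breaker wins. $\deg_M(v)$ and $\deg_B(v)$ denote the number of edges at $v$ claimed by Maker and by Breaker, respectively; a subscript $t$ (e.g. $\deg_{M,t}(v)$) denotes the value directly after turn $t$, and index $0$ refers to the start of the game. Fix $\delta\in(0,1-\frac{8}{3\beta})$. Let $p_0=\frac{8}{\beta(1-\delta)(3+\delta)}$ and $\mu=1+\frac{6\beta\ln n}{\delta q}$. For $v\in V$ define the balanced Breaker-degree $\deg^*(v)=n-p_0\left(\frac{q^2(1-\delta)(3+\delta)}{8}-\deg_M(v)\left(q-\frac{\deg_M(v)}{2}\right)\right)$, the deficit $d(v)=\deg^*(v)-\deg_B(v)$, and the potential $\mathrm{pot}(v)=0$ if $\deg_M(v)+\deg_B(v)=n-1$, and $\mathrm{pot}(v)=\mu^{d(v)/q}$ otherwise. For an unclaimed edge $e=\{x,y\}$ let $\mathrm{pot}(e)=\mathrm{pot}(x)+\mathrm{pot}(y)$. Breaker's strategy: in a turn $t$ let $\{u,v\}$ be the edge Maker has just claimed. Part 1 (closing edges): Breaker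 claims $\deg_{M,t-1}(v)$ edges incident to $u$ and $\deg_{M,t-1}(u)$ edges incident to $v$, namely the edges closing all newly created Maker paths of length $2$ (for each Maker-neighbour $w$ of $v$ the edge $\{u,w\}$, and for each Maker-neighbour $w$ of $u$ the edge $\{v,w\}$); if such an edge is already claimed, he claims an arbitrary unclaimed edge incident to $u$ (resp. $v$) instead; if no unclaimed edge incident to $u$ (resp. $v$) remains, he claims arbitrary unclaimed edges instead. Part 2 (free edges): with his remaining edges in this turn, Breaker iteratively claims an unclaimed edge $e$ with $\mathrm{pot}(e)\ge\mathrm{pot}(e')$ for all unclaimed edges $e'$ (potentials evaluated in the current position), until he has claimed $q$ edges in this turn. *)

theory Defs
  imports Complex_Main
begin

definition complete_edges :: "'a set \<Rightarrow> 'a set set" where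
  "complete_edges V = {{x, y} | x y. x \<in> V \<and> y \<in> V \<and> x \<noteq> y}"

text \<open>A position is a pair of the set of Maker's edges and the set of Breaker's edges.\<close>

type_synonym 'a position = "'a set set \<times> 'a set set"

definition unclaimed :: "'a set \<Rightarrow> 'a position \<Rightarrow> 'a set set" where
  "unclaimed V P = complete_edges V - (fst P \<union> snd P)"

definition maker_claims :: "'a set \<Rightarrow> 'a position \<Rightarrow> 'a position" where
  "maker_claims e P = (insert e (fst P), snd P)"

definition breaker_claims :: "'a set \<Rightarrow> 'a position \<Rightarrow> 'a position" where
  "breaker_claims e P = (fst P, insert e (snd P))"

definition deg_M :: "'a position \<Rightarrow> 'a \<Rightarrow> nat" where
  "deg_M P v = card {e \<in> fst P. v \<in> e}"

definition deg_B :: "'a position \<Rightarrow> 'a \<Rightarrow> nat" where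
  "deg_B P v = card {e \<in> snd P. v \<in> e}"

definition maker_nbrs :: "'a position \<Rightarrow> 'a \<Rightarrow> 'a set" where
  "maker_nbrs P v = {w. {v, w} \<in> fst P}"

definition maker_has_triangle :: "'a position \<Rightarrow> bool" where
  "maker_has_triangle P \<longleftrightarrow>
     (\<exists>x y z. x \<noteq> y \<and> y \<noteq> z \<and> x \<noteq> z \<and> {x, y} \<in> fst P \<and> {y, z} \<in> fst P \<and> {x, z} \<in> fst P)"

definition game_over :: "'a set \<Rightarrow> 'a position \<Rightarrow> bool" where
  "game_over V P \<longleftrightarrow> unclaimed V P = {}"

definition breaker_wins :: "'a set \<Rightarrow> 'a position \<Rightarrow> bool" where
  "breaker_wins V P \<longleftrightarrow> game_over V P \<and> \<not> maker_has_triangle P"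


definition p0 :: "real \<Rightarrow> real \<Rightarrow> real" where
  "p0 \<beta> \<delta> = 8 / (\<beta> * (1 - \<delta>) * (3 + \<delta>))"

definition mu :: "real \<Rightarrow> real \<Rightarrow> nat \<Rightarrow> nat \<Rightarrow> real" where
  "mu \<beta> \<delta> n q = 1 + 6 * \<beta> * ln (real n) / (\<delta> * real q)"

definition balanced_deg :: "'a set \<Rightarrow> nat \<Rightarrow> real \<Rightarrow> real \<Rightarrow> 'a position \<Rightarrow> 'a \<Rightarrow> real" where
  "balanced_deg V q \<beta> \<delta> P v =
     real (card V) - p0 \<beta> \<delta> *
       ((real q)\<^sup>2 * (1 - \<delta>) * (3 + \<delta>) / 8
        - real (deg_M P v) * (real q - real (deg_M P v) / 2))"

definition deficit :: "'a set \<Rightarrow> nat \<Rightarrow> real \<Rightarrow> real \<Rightarrow> 'a position \<Rightarrow> 'a \<Rightarrow> real" where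
  "deficit V q \<beta> \<delta> P v = balanced_deg V q \<beta> \<delta> P v - real (deg_B P v)"

definition pot :: "'a set \<Rightarrow> nat \<Rightarrow> real \<Rightarrow> real \<Rightarrow> 'a position \<Rightarrow> 'a \<Rightarrow> real" where
  "pot V q \<beta> \<delta> P v =
     (if deg_M P v + deg_B P v = card V - 1 then 0
      else mu \<beta> \<delta> (card V) q powr (deficit V q \<beta> \<delta> P v / real q))"

definition edge_pot :: "'a set \<Rightarrow> nat \<Rightarrow> real \<Rightarrow> real \<Rightarrow> 'a position \<Rightarrow> 'a set \<Rightarrow> real" where
  "edge_pot V q \<beta> \<delta> P e = (\<Sum>x\<in>e. pot V q \<beta> \<delta> P x)"


text \<open>A task \<open>(a, w)\<close> asks Breaker to close the Maker path from \<open>a\<close> to \<open>w\<close> of length two by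
  claiming the edge \<open>{a, w}\<close>, or else a substitute, at \<open>a\<close> if possible.\<close>

definition closing_choices :: "'a set \<Rightarrow> 'a position \<Rightarrow> 'a \<times> 'a \<Rightarrow> 'a set set" where
  "closing_choices V P t =
     (let a = fst t; w = snd t; U = unclaimed V P in
      if {a, w} \<in> U then {{a, w}}
      else if \<exists>e\<in>U. a \<in> e then {e \<in> U. a \<in> e}
      else U)"

definition free_choices ::
    "'a set \<Rightarrow> nat \<Rightarrow> real \<Rightarrow> real \<Rightarrow> 'a position \<Rightarrow> 'a set set" where
  "free_choices V q \<beta> \<delta> P =
     {e \<in> unclaimed V P. \<forall>e'\<in>unclaimed V P. edge_pot V q \<beta> \<delta> P e' \<le> edge_pot V q \<beta> \<delta> P e}"

text \<open>\<open>breaker_turn V q \<beta> \<delta> ts k P P'\<close>: with closing tasks \<open>ts\<close> still to be processed and \<open>k\<close>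
  edges still to be claimed in this turn, Breaker can get from \<open>P\<close> to \<open>P'\<close>. The turn is cut short
  only if no unclaimed edges are left; tasks beyond the \<open>q\<close>-th one, if any, are dropped.\<close>

inductive breaker_turn ::
    "'a set \<Rightarrow> nat \<Rightarrow> real \<Rightarrow> real \<Rightarrow> ('a \<times> 'a) list \<Rightarrow> nat \<Rightarrow> 'a position \<Rightarrow> 'a position \<Rightarrow> bool"
  for V :: "'a set" and q :: nat and \<beta> \<delta> :: real where
  stop: "k = 0 \<or> unclaimed V P = {} \<Longrightarrow> breaker_turn V q \<beta> \<delta> ts k P P"
| closing: "\<lbrakk>e \<in> closing_choices V P t; breaker_turn V q \<beta> \<delta> ts k (breaker_claims e P) P'\<rbrakk>
    \<Longrightarrow> breaker_turn V q \<beta> \<delta> (t # ts) (Suc k) P P'"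
| free: "\<lbrakk>e \<in> free_choices V q \<beta> \<delta> P; breaker_turn V q \<beta> \<delta> [] k (breaker_claims e P) P'\<rbrakk>
    \<Longrightarrow> breaker_turn V q \<beta> \<delta> [] (Suc k) P P'"

text \<open>The positions directly after the turns of a game in which Maker plays arbitrarily and Breaker
  follows the strategy. The closing tasks may be processed in any order.\<close>

inductive reachable :: "'a set \<Rightarrow> nat \<Rightarrow> real \<Rightarrow> real \<Rightarrow> 'a position \<Rightarrow> bool"
  for V :: "'a set" and q :: nat and \<beta> \<delta> :: real where
  start: "reachable V q \<beta> \<delta> ({}, {})"
| turn: "\<lbrakk>reachable V q \<beta> \<delta> P; {u, v} \<in> unclaimed V P; distinct ts;
      set ts = {u} \<times> maker_nbrs P v \<union> {v} \<times> maker_nbrs P u;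
      breaker_turn V q \<beta> \<delta> ts q (maker_claims {u, v} P) P'\<rbrakk>
    \<Longrightarrow> reachable V q \<beta> \<delta> P'"

end

theory Submission
  imports Defs "HOL-Real_Asymp.Real_Asymp"
begin

text \<open>
  Let \<open>S\<close> be the sum of the potentials of all vertices and \<open>M\<close> the largest potential of an unclaimed
  edge. Then \<open>S + ln \<mu> * M\<close> does not increase from turn to turn: if \<open>f\<close> is the number of free edges
  of a turn, Maker's edge and Part 1 multiply the potentials of its two ends by at most
  \<open>\<mu> powr (p\<^sub>0 f / q)\<close>, which costs about \<open>p\<^sub>0 (f / q) (ln \<mu>) M\<close>, while each free edge decreases \<open>S\<close>
  by about \<open>(ln \<mu> / q) M'\<close>, where \<open>M'\<close> is the value of \<open>M\<close> after the turn. Either \<open>M'\<close> is close to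
  \<open>M\<close>, and the free edges win because \<open>p\<^sub>0 < 1\<close>, or the second summand pays for the loss.

  Hence all potentials stay below \<open>n\<^sup>2\<close>, so the deficit of a vertex with an unclaimed edge is at most
  about \<open>\<delta> n / 2\<close>. With Maker-degree close to \<open>q / 2\<close> the balanced degree exceeds \<open>n\<close> by about
  \<open>2 \<delta> n / 3\<close>, so such a vertex has no unclaimed edge. Therefore Maker-degrees stay below \<open>q / 2\<close>, and
  Breaker can always close all new Maker paths.
\<close>

section \<open>Positions and degrees\<close>

definition star :: "'a \<Rightarrow> 'a set set \<Rightarrow> 'a set set" where
  "star v E = {e \<in> E. v \<in> e}"

definition legal :: "'a set \<Rightarrow> 'a position \<Rightarrow> bool" where
  "legal V P \<longleftrightarrow> fst P \<subseteq> complete_edges V \<and> snd P \<subseteq> complete_edges V \<and> fst P \<inter> snd P = {}"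

definition open_vertex :: "'a set \<Rightarrow> 'a position \<Rightarrow> 'a \<Rightarrow> bool" where
  "open_vertex V P v \<longleftrightarrow> star v (unclaimed V P) \<noteq> {}"

lemma doubleton_in_complete_edges_iff: "{x, y} \<in> complete_edges V \<longleftrightarrow> x \<in> V \<and> y \<in> V \<and> x \<noteq> y"
  by (auto simp: complete_edges_def doubleton_eq_iff)

lemma finite_complete_edges: "finite V \<Longrightarrow> finite (complete_edges V)"
  by (rule finite_subset[of _ "Pow V"]) (auto simp: complete_edges_def)

lemma finite_unclaimed: "finite V \<Longrightarrow> finite (unclaimed V P)"
  by (simp add: unclaimed_def finite_complete_edges)

lemma unclaimed_doubletonE:
  assumes "e \<in> unclaimed V P"
  obtains x y where "e = {x, y}" "x \<in> V" "y \<in> V" "x \<noteq> y"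
  using assms by (auto simp: unclaimed_def complete_edges_def)

lemma unclaimed_doubletonD:
  assumes "{x, y} \<in> unclaimed V P"
  shows "x \<in> V" "y \<in> V" "x \<noteq> y"
  using assms by (simp_all add: unclaimed_def doubleton_in_complete_edges_iff)

lemma unclaimed_subset: "e \<in> unclaimed V P \<Longrightarrow> e \<subseteq> V"
  by (auto elim: unclaimed_doubletonE)

lemma legal_finite:
  assumes "finite V" "legal V P"
  shows "finite (fst P)" "finite (snd P)"
  using assms finite_complete_edges finite_subset by (auto simp: legal_def)

lemma open_vertex_mono:
  "open_vertex V P' v \<Longrightarrow> unclaimed V P' \<subseteq> unclaimed V P \<Longrightarrow> open_vertex V P v"
  by (auto simp: open_vertex_def star_def)

lemma deg_M_eq_card_star: "deg_M P v = card (star v (fst P))"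
  by (simp add: deg_M_def star_def)

lemma deg_B_eq_card_star: "deg_B P v = card (star v (snd P))"
  by (simp add: deg_B_def star_def)

lemma star_Un: "star v (E \<union> F) = star v E \<union> star v F"
  by (auto simp: star_def)

lemma star_disjoint: "E \<inter> F = {} \<Longrightarrow> star v E \<inter> star v F = {}"
  by (auto simp: star_def)

lemma finite_star: "finite E \<Longrightarrow> finite (star v E)"
  by (simp add: star_def)

lemma card_star_Un_disjoint:
  assumes "finite E" "finite F" "E \<inter> F = {}"
  shows "card (star v (E \<union> F)) = card (star v E) + card (star v F)"
  using assms by (simp add: star_Un card_Un_disjoint finite_star star_disjoint)

lemma card_star_insert:
  assumes "finite E" "e \<notin> E"
  shows "card (star v (insert e E)) = card (star v E) + (if v \<in> e then 1 else 0)"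
proof -
  have "star v (insert e E) = (if v \<in> e then insert e (star v E) else star v E)"
    by (auto simp: star_def)
  thus ?thesis using assms by (simp add: star_def)
qed

lemma card_image_doubletons: "card ((\<lambda>w. {v, w}) ` W) = card W"
  by (rule card_image) (auto simp: inj_on_def doubleton_eq_iff)

lemma card_star_complete_edges:
  assumes "v \<in> V"
  shows "card (star v (complete_edges V)) = card V - 1"
proof -
  have "star v (complete_edges V) = (\<lambda>w. {v, w}) ` (V - {v})"
    using assms by (auto simp: star_def complete_edges_def insert_commute)
  thus ?thesis using assms by (simp add: card_image_doubletons card_Diff_singleton)
qed

lemma deg_sum:
  assumes "finite V" "legal V P" "v \<in> V"
  shows "deg_M P v + deg_B P v + card (star v (unclaimed V P)) = card V - 1"
proof -
  have "complete_edges V = (fst P \<union> snd P) \<union> unclaimed V P"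
    using assms(2) by (auto simp: legal_def unclaimed_def)
  hence "card V - 1 = card (star v ((fst P \<union> snd P) \<union> unclaimed V P))"
    using card_star_complete_edges[OF assms(3)] by simp
  also have "\<dots> = card (star v (fst P \<union> snd P)) + card (star v (unclaimed V P))"
    using legal_finite[OF assms(1,2)] finite_unclaimed[OF assms(1)]
    by (intro card_star_Un_disjoint) (auto simp: unclaimed_def)
  also have "card (star v (fst P \<union> snd P)) = deg_M P v + deg_B P v"
    using legal_finite[OF assms(1,2)] assms(2)
    by (simp add: card_star_Un_disjoint deg_M_eq_card_star deg_B_eq_card_star legal_def)
  finally show ?thesis by simp
qed

lemma deg_sum_eq_iff_not_open:
  assumes "finite V" "legal V P" "v \<in> V"
  shows "deg_M P v + deg_B P v = card V - 1 \<longleftrightarrow> \<not> open_vertex V P v"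
proof -
  have "card (star v (unclaimed V P)) = 0 \<longleftrightarrow> \<not> open_vertex V P v"
    using assms(1) by (simp add: open_vertex_def finite_star finite_unclaimed)
  thus ?thesis using deg_sum[OF assms] by linarith
qed

lemma card_maker_nbrs:
  assumes "legal V P"
  shows "card (maker_nbrs P v) = deg_M P v"
proof -
  have "star v (fst P) = (\<lambda>w. {v, w}) ` maker_nbrs P v"
  proof (intro set_eqI iffI)
    fix e assume in_star: "e \<in> star v (fst P)"
    then obtain x y where "e = {x, y}"
      using assms by (auto simp: star_def legal_def complete_edges_def)
    with in_star show "e \<in> (\<lambda>w. {v, w}) ` maker_nbrs P v"
      by (auto simp: star_def maker_nbrs_def insert_commute image_iff)
  qed (auto simp: star_def maker_nbrs_def)
  thus ?thesis by (simp add: deg_M_eq_card_star card_image_doubletons)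
qed

lemma finite_maker_nbrs:
  assumes "finite V" "legal V P"
  shows "finite (maker_nbrs P v)"
proof (rule finite_subset[OF _ assms(1)])
  show "maker_nbrs P v \<subseteq> V"
    using assms(2) by (auto simp: maker_nbrs_def legal_def doubleton_in_complete_edges_iff)
qed

lemma unclaimed_maker_claims: "unclaimed V (maker_claims e P) = unclaimed V P - {e}"
  by (auto simp: unclaimed_def maker_claims_def)

lemma legal_maker_claims:
  "legal V P \<Longrightarrow> e \<in> unclaimed V P \<Longrightarrow> legal V (maker_claims e P)"
  by (auto simp: legal_def maker_claims_def unclaimed_def)

lemma deg_B_maker_claims: "deg_B (maker_claims e P) v = deg_B P v"
  by (simp add: deg_B_def maker_claims_def)

lemma deg_M_maker_claims:
  assumes "finite V" "legal V P" "e \<in> unclaimed V P"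
  shows "deg_M (maker_claims e P) v = deg_M P v + (if v \<in> e then 1 else 0)"
  using card_star_insert[OF legal_finite(1)[OF assms(1,2)], of e v] assms(3)
  by (simp add: deg_M_eq_card_star maker_claims_def unclaimed_def)

lemma deg_B_breaker_claims:
  assumes "finite V" "legal V P" "e \<in> unclaimed V P"
  shows "deg_B (breaker_claims e P) v = deg_B P v + (if v \<in> e then 1 else 0)"
  using card_star_insert[OF legal_finite(2)[OF assms(1,2)], of e v] assms(3)
  by (simp add: deg_B_eq_card_star breaker_claims_def unclaimed_def)

section \<open>Breaker's turns\<close>

definition breaker_extends :: "'a set \<Rightarrow> 'a position \<Rightarrow> 'a position \<Rightarrow> bool" where
  "breaker_extends V P P' \<longleftrightarrow>
     fst P' = fst P \<and> snd P \<subseteq> snd P' \<and> snd P' \<subseteq> snd P \<union> unclaimed V P"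

lemma breaker_extends_refl: "breaker_extends V P P"
  by (simp add: breaker_extends_def)

lemma breaker_extends_breaker_claims: "e \<in> unclaimed V P \<Longrightarrow> breaker_extends V P (breaker_claims e P)"
  by (auto simp: breaker_extends_def breaker_claims_def)

lemma breaker_extends_trans:
  "breaker_extends V P Q \<Longrightarrow> breaker_extends V Q R \<Longrightarrow> breaker_extends V P R"
  by (auto simp: breaker_extends_def unclaimed_def)

lemma breaker_extends_legal: "breaker_extends V P P' \<Longrightarrow> legal V P \<Longrightarrow> legal V P'"
  by (auto simp: breaker_extends_def legal_def unclaimed_def)

lemma breaker_extends_unclaimed: "breaker_extends V P P' \<Longrightarrow> unclaimed V P' \<subseteq> unclaimed V P"
  by (auto simp: breaker_extends_def unclaimed_def)

lemma breaker_extends_deg_M: "breaker_extends V P P' \<Longrightarrow> deg_M P' v = deg_M P v"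
  by (simp add: breaker_extends_def deg_M_def)

lemma breaker_extends_deg_B:
  assumes "finite V" "legal V P" "breaker_extends V P P'"
  shows "deg_B P v \<le> deg_B P' v"
proof -
  have "finite (snd P')"
    using legal_finite(2)[OF assms(1)] breaker_extends_legal assms(2,3) by blast
  thus ?thesis
    using assms(3) unfolding deg_B_def breaker_extends_def by (intro card_mono) auto
qed

lemma closing_choices_subset: "closing_choices V P t \<subseteq> unclaimed V P"
  by (auto simp: closing_choices_def Let_def split: if_splits)

lemma free_choices_subset: "free_choices V q \<beta> \<delta> P \<subseteq> unclaimed V P"
  by (auto simp: free_choices_def)

lemma closing_choices_incident:
  "e \<in> closing_choices V P t \<Longrightarrow> open_vertex V P (fst t) \<Longrightarrow> fst t \<in> e"
  by (auto simp: closing_choices_def Let_def open_vertex_def star_def split: if_splits)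

lemma closing_choices_claimed:
  "e \<in> closing_choices V P (a, w) \<Longrightarrow> {a, w} \<notin> unclaimed V (breaker_claims e P)"
  by (auto simp: closing_choices_def Let_def unclaimed_def breaker_claims_def split: if_splits)

lemma breaker_turn_extends:
  assumes "breaker_turn V q \<beta> \<delta> ts k P P'"
  shows "breaker_extends V P P'"
  using assms
proof (induction rule: breaker_turn.induct)
  case (closing e P t ts k P')
  thus ?case
    using closing_choices_subset breaker_extends_breaker_claims breaker_extends_trans by blast
next
  case (free e P k P')
  thus ?case
    using free_choices_subset breaker_extends_breaker_claims breaker_extends_trans by blast
qed (rule breaker_extends_refl)

lemma breaker_turn_closes:
  assumes "breaker_turn V q \<beta> \<delta> ts k P P'" "length ts \<le> k" "(a, w) \<in> set ts"
  shows "{a, w} \<notin> unclaimed V P'"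
  using assms
proof (induction rule: breaker_turn.induct)
  case (closing e P t ts k P')
  show ?case
  proof (cases "t = (a, w)")
    case True
    hence "{a, w} \<notin> unclaimed V (breaker_claims e P)"
      using closing.hyps(1) by (simp add: closing_choices_claimed)
    thus ?thesis
      using breaker_extends_unclaimed[OF breaker_turn_extends[OF closing.hyps(2)]] by blast
  next
    case False
    thus ?thesis using closing by auto
  qed
qed auto

text \<open>A vertex that has lost its last unclaimed edge may receive fewer closing edges than tasks.\<close>

lemma breaker_turn_closing_phase:
  assumes "breaker_turn V q \<beta> \<delta> ts k P P'" "finite V" "legal V P" "length ts \<le> k"
  shows "\<exists>P\<^sub>1. breaker_extends V P P\<^sub>1 \<and> breaker_turn V q \<beta> \<delta> [] (k - length ts) P\<^sub>1 P' \<and>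
    (\<forall>v. open_vertex V P\<^sub>1 v \<longrightarrow> deg_B P v + count_list (map fst ts) v \<le> deg_B P\<^sub>1 v)"
  using assms
proof (induction rule: breaker_turn.induct)
  case (stop k P ts)
  have "breaker_turn V q \<beta> \<delta> [] (k - length ts) P P"
    using stop.hyps by (intro breaker_turn.stop) auto
  moreover have "deg_B P v + count_list (map fst ts) v \<le> deg_B P v" if "open_vertex V P v" for v
    using stop that by (auto simp: open_vertex_def star_def)
  ultimately show ?case using breaker_extends_refl by blast
next
  case (closing e P t ts k P')
  have unclaimed: "e \<in> unclaimed V P" using closing.hyps(1) closing_choices_subset by blast
  note extends = breaker_extends_breaker_claims[OF unclaimed]
  obtain P\<^sub>1 where extends_rest: "breaker_extends V (breaker_claims e P) P\<^sub>1"
    and free_phase: "breaker_turn V q \<beta> \<delta> [] (k - length ts) P\<^sub>1 P'"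
    and tasks_done: "\<And>v. open_vertex V P\<^sub>1 v \<Longrightarrow>
      deg_B (breaker_claims e P) v + count_list (map fst ts) v \<le> deg_B P\<^sub>1 v"
    using closing.IH closing.prems breaker_extends_legal[OF extends] by auto
  have extends_all: "breaker_extends V P P\<^sub>1"
    using extends extends_rest by (rule breaker_extends_trans)
  have "deg_B P v + count_list (map fst (t # ts)) v \<le> deg_B P\<^sub>1 v" if "open_vertex V P\<^sub>1 v" for v
  proof -
    have "open_vertex V P v"
      using that breaker_extends_unclaimed[OF extends_all] by (rule open_vertex_mono)
    hence "deg_B P v + (if fst t = v then 1 else 0) \<le> deg_B (breaker_claims e P) v"
      using closing_choices_incident[OF closing.hyps(1)]
        deg_B_breaker_claims[OF closing.prems(1,2) unclaimed] by auto
    thus ?thesis using tasks_done[OF that] by auto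
  qed
  thus ?case using extends_all free_phase by (intro exI[of _ P\<^sub>1]) simp
next
  case (free e P k P')
  have "breaker_turn V q \<beta> \<delta> [] (Suc k) P P'" using free.hyps by (rule breaker_turn.free)
  thus ?case by (intro exI[of _ P]) (simp add: breaker_extends_refl)
qed

definition closing_tasks :: "'a position \<Rightarrow> 'a \<Rightarrow> 'a \<Rightarrow> ('a \<times> 'a) list \<Rightarrow> bool" where
  "closing_tasks P u v ts \<longleftrightarrow>
     distinct ts \<and> set ts = {u} \<times> maker_nbrs P v \<union> {v} \<times> maker_nbrs P u"

lemma closing_tasks_commute: "closing_tasks P u v ts \<longleftrightarrow> closing_tasks P v u ts"
  by (auto simp: closing_tasks_def)

lemma count_closing_tasks:
  assumes "legal V P" "closing_tasks P u v ts" "u \<noteq> v"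
  shows "count_list (map fst ts) u = deg_M P v"
proof -
  have tasks: "distinct ts" "set ts = {u} \<times> maker_nbrs P v \<union> {v} \<times> maker_nbrs P u"
    using assms(2) by (simp_all add: closing_tasks_def)
  have "count_list (map fst ts) u = length (filter (\<lambda>t. u = fst t) ts)"
    by (simp add: count_list_eq_length_filter filter_map comp_def)
  also have "\<dots> = card {t \<in> set ts. u = fst t}"
    using tasks(1) by (simp add: distinct_card[symmetric])
  also have "{t \<in> set ts. u = fst t} = {u} \<times> maker_nbrs P v"
    unfolding tasks(2) using assms(3) by auto
  also have "card \<dots> = deg_M P v"
    using card_maker_nbrs[OF assms(1)] by (simp add: card_cartesian_product)
  finally show ?thesis .
qed

lemma length_closing_tasks:
  assumes "finite V" "legal V P" "closing_tasks P u v ts" "u \<noteq> v"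
  shows "length ts = deg_M P u + deg_M P v"
proof -
  have "length ts = card ({u} \<times> maker_nbrs P v \<union> {v} \<times> maker_nbrs P u)"
    using assms(3) unfolding closing_tasks_def by (metis distinct_card)
  also have "\<dots> = card ({u} \<times> maker_nbrs P v) + card ({v} \<times> maker_nbrs P u)"
    using finite_maker_nbrs[OF assms(1,2)] assms(4) by (intro card_Un_disjoint) auto
  also have "\<dots> = deg_M P u + deg_M P v"
    using card_maker_nbrs[OF assms(2)] by (simp add: card_cartesian_product)
  finally show ?thesis .
qed

lemma closing_phase_deg_B:
  assumes "finite V" "legal V P" "{u, v} \<in> unclaimed V P" "closing_tasks P u v ts"
    and "deg_M P u + deg_M P v \<le> k" "breaker_turn V q \<beta> \<delta> ts k (maker_claims {u, v} P) P'"
  obtains P\<^sub>1 where "breaker_extends V (maker_claims {u, v} P) P\<^sub>1"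
    "breaker_turn V q \<beta> \<delta> [] (k - (deg_M P u + deg_M P v)) P\<^sub>1 P'"
    "\<And>x y. {x, y} = {u, v} \<Longrightarrow> open_vertex V P\<^sub>1 x \<Longrightarrow> deg_B P x + deg_M P y \<le> deg_B P\<^sub>1 x"
proof -
  note distinct_ends = unclaimed_doubletonD(3)[OF assms(3)]
  have "length ts = deg_M P u + deg_M P v"
    using assms(1,2,4) distinct_ends by (rule length_closing_tasks)
  then obtain P\<^sub>1 where extends: "breaker_extends V (maker_claims {u, v} P) P\<^sub>1"
    and free_phase: "breaker_turn V q \<beta> \<delta> [] (k - (deg_M P u + deg_M P v)) P\<^sub>1 P'"
    and tasks_done: "\<And>x. open_vertex V P\<^sub>1 x \<Longrightarrow>
      deg_B (maker_claims {u, v} P) x + count_list (map fst ts) x \<le> deg_B P\<^sub>1 x"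
    using breaker_turn_closing_phase[OF assms(6,1) legal_maker_claims[OF assms(2,3)]] assms(5)
    by auto
  have "deg_B P x + deg_M P y \<le> deg_B P\<^sub>1 x" if "{x, y} = {u, v}" "open_vertex V P\<^sub>1 x" for x y
  proof -
    have "closing_tasks P x y ts" "x \<noteq> y"
      using that(1) distinct_ends assms(4) closing_tasks_commute[of P u v]
      by (auto simp: doubleton_eq_iff)
    hence "count_list (map fst ts) x = deg_M P y" by (rule count_closing_tasks[OF assms(2)])
    thus ?thesis using tasks_done[OF that(2)] by (simp add: deg_B_maker_claims)
  qed
  with extends free_phase show ?thesis by (rule that)
qed

section \<open>Closed Maker paths\<close>

definition paths_closed :: "'a position \<Rightarrow> bool" where
  "paths_closed P \<longleftrightarrow>
     (\<forall>x y z. {y, x} \<in> fst P \<longrightarrow> {y, z} \<in> fst P \<longrightarrow> x \<noteq> z \<longrightarrow> {x, z} \<in> snd P)"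

lemma paths_closed_no_triangle:
  assumes "legal V P" "paths_closed P"
  shows "\<not> maker_has_triangle P"
proof
  assume "maker_has_triangle P"
  then obtain x y z where "x \<noteq> z" "{x, y} \<in> fst P" "{y, z} \<in> fst P" "{x, z} \<in> fst P"
    unfolding maker_has_triangle_def by blast
  moreover from this have "{y, x} \<in> fst P" by (simp only: insert_commute)
  ultimately show False using assms unfolding paths_closed_def legal_def by blast
qed

lemma new_path_end_not_maker:
  assumes "legal V P" "paths_closed P" "{a, b} \<in> unclaimed V P" "{b, w} \<in> fst P"
  shows "{a, w} \<notin> fst P"
proof
  assume "{a, w} \<in> fst P"
  hence "{w, a} \<in> fst P" "{w, b} \<in> fst P" using assms(4) by (simp_all only: insert_commute)
  moreover have "a \<noteq> b" using unclaimed_doubletonD[OF assms(3)] by simp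
  ultimately have "{a, b} \<in> snd P" using assms(2) unfolding paths_closed_def by blast
  thus False using assms(3) by (simp add: unclaimed_def)
qed

lemma new_path_closed:
  assumes "legal V P" "paths_closed P" "{a, b} \<in> unclaimed V P" "{b, w} \<in> fst P" "w \<noteq> a"
    and "fst P' = insert {a, b} (fst P)" "{a, w} \<notin> unclaimed V P'"
  shows "{a, w} \<in> snd P'"
proof -
  have "{b, w} \<in> complete_edges V" using assms(1,4) by (auto simp: legal_def)
  hence "w \<in> V" "b \<noteq> w" by (simp_all add: doubleton_in_complete_edges_iff)
  hence "{a, w} \<in> complete_edges V" "{a, w} \<noteq> {a, b}"
    using unclaimed_doubletonD[OF assms(3)] assms(5)
    by (auto simp: doubleton_in_complete_edges_iff doubleton_eq_iff)
  moreover have "{a, w} \<notin> fst P" using assms(1-4) by (rule new_path_end_not_maker)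
  ultimately show ?thesis using assms(6,7) by (simp add: unclaimed_def)
qed

lemma paths_closed_insert:
  assumes "paths_closed P" "fst P' = insert {u, v} (fst P)" "snd P \<subseteq> snd P'"
    and new_closed: "\<And>a b w. {b, a} = {u, v} \<Longrightarrow> {b, w} \<in> fst P \<Longrightarrow> w \<noteq> a \<Longrightarrow> {a, w} \<in> snd P'"
  shows "paths_closed P'"
  unfolding paths_closed_def
proof (intro allI impI)
  fix x y z assume path: "{y, x} \<in> fst P'" "{y, z} \<in> fst P'" "x \<noteq> z"
  consider (old) "{y, x} \<in> fst P" "{y, z} \<in> fst P" | (new_x) "{y, x} = {u, v}" "{y, z} \<in> fst P"
    | (new_z) "{y, z} = {u, v}" "{y, x} \<in> fst P" | (same) "{y, x} = {y, z}"
    using path assms(2) by auto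
  thus "{x, z} \<in> snd P'"
  proof cases
    case old
    thus ?thesis using assms(1,3) path(3) unfolding paths_closed_def by blast
  next
    case new_x
    thus ?thesis using new_closed path(3) by blast
  next
    case new_z
    hence "{z, x} \<in> snd P'" using new_closed path(3) by blast
    thus ?thesis by (simp only: insert_commute)
  next
    case same
    thus ?thesis using path(3) by (auto simp: doubleton_eq_iff)
  qed
qed

lemma breaker_turn_paths_closed:
  assumes "finite V" "legal V P" "paths_closed P" "{u, v} \<in> unclaimed V P" "closing_tasks P u v ts"
    and "deg_M P u + deg_M P v \<le> k" "breaker_turn V q \<beta> \<delta> ts k (maker_claims {u, v} P) P'"
  shows "paths_closed P'"
proof -
  have maker: "fst P' = insert {u, v} (fst P)" and breaker: "snd P \<subseteq> snd P'"
    using breaker_turn_extends[OF assms(7)] by (auto simp: breaker_extends_def maker_claims_def)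
  have enough_edges: "length ts \<le> k"
    using length_closing_tasks[OF assms(1,2,5)] unclaimed_doubletonD(3)[OF assms(4)] assms(6)
    by simp
  show ?thesis
  proof (rule paths_closed_insert[OF assms(3) maker breaker])
    fix a b w assume "{b, a} = {u, v}" and path: "{b, w} \<in> fst P" "w \<noteq> a"
    hence edge: "{a, b} = {u, v}" by (simp only: insert_commute)
    hence "(a, w) \<in> set ts"
      using assms(5) path(1) by (auto simp: closing_tasks_def maker_nbrs_def doubleton_eq_iff)
    hence "{a, w} \<notin> unclaimed V P'" by (rule breaker_turn_closes[OF assms(7) enough_edges])
    thus "{a, w} \<in> snd P'"
      using assms(4) maker path unfolding edge[symmetric] by (intro new_path_closed[OF assms(2,3)])
  qed
qed

section \<open>The potential of a position\<close>

lemma mult_one_minus_le_one_minus_exp: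
  fixes y :: real
  assumes "0 \<le> y"
  shows "y * (1 - y) \<le> 1 - exp (- y)"
proof -
  have "exp (- y) \<le> 1 / (1 + y)"
    using exp_ge_add_one_self[of y] assms by (simp add: exp_minus field_simps)
  also have "\<dots> \<le> 1 - y * (1 - y)"
    using assms by (simp add: field_simps)
  finally show ?thesis by simp
qed

lemma mult_exp_minus_one_le:
  fixes p L \<theta> :: real
  assumes "0 \<le> \<theta>" "\<theta> \<le> L" "0 \<le> p" "4 * L \<le> 1 - p"
  shows "(1 + L) * (exp (p * \<theta>) - 1) \<le> (1 - L) * \<theta>"
proof -
  have "p \<le> 1" and L_bounds: "0 \<le> L" "L \<le> 1" using assms by auto
  hence p\<theta>_bounds: "0 \<le> p * \<theta>" "p * \<theta> \<le> \<theta>" using assms by (auto simp: mult_left_le_one_le)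
  have "exp (p * \<theta>) \<le> 1 + p * \<theta> + (p * \<theta>)\<^sup>2"
    using p\<theta>_bounds assms L_bounds by (intro exp_bound) auto
  also have "(p * \<theta>)\<^sup>2 \<le> L * \<theta>"
    unfolding power2_eq_square using p\<theta>_bounds assms by (intro mult_mono) auto
  finally have "(1 + L) * (exp (p * \<theta>) - 1) \<le> (1 + L) * ((p + L) * \<theta>)"
    using L_bounds by (intro mult_left_mono) (auto simp: algebra_simps)
  also have "\<dots> = (1 + L) * (p + L) * \<theta>" by (simp only: mult.assoc)
  also have "\<dots> \<le> (1 - L) * \<theta>"
  proof (rule mult_right_mono)
    have "L * (p + L) \<le> L * 1" using assms L_bounds by (intro mult_left_mono) auto
    thus "(1 + L) * (p + L) \<le> 1 - L" using assms L_bounds by (simp add: algebra_simps)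
  qed (rule assms(1))
  finally show ?thesis .
qed

text \<open>\<open>S\<close> and \<open>M\<close> are the total and the maximal potential before a turn, \<open>S'\<close> and \<open>M'\<close> those after
  it; \<open>1 + x\<close> is the growth factor of Maker's edge and Part 1, and \<open>D\<close> the loss due to Part 2.\<close>

lemma turn_balance:
  fixes S S' M M' L D x :: real
  assumes "S' + D * M' \<le> S + x * M" "M' \<le> (1 + x) * M" "(1 + L) * x \<le> D" "D \<le> L"
    and "0 \<le> M" "0 \<le> x" "0 \<le> D"
  shows "S' + L * M' \<le> S + L * M"
proof -
  have "(L - D) * M' \<le> (L - D) * ((1 + x) * M)"
    using assms(2,4) by (intro mult_left_mono) auto
  hence "S' + L * M' \<le> S + x * M + (L - D) * ((1 + x) * M)"
    using assms(1) by (simp add: left_diff_distrib)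
  also have "\<dots> = S + ((1 + L) * x - D * x + (L - D)) * M" by (simp add: algebra_simps)
  also have "\<dots> \<le> S + L * M"
  proof -
    have "(1 + L) * x - D * x + (L - D) \<le> L"
      using assms(3) mult_nonneg_nonneg[OF assms(7,6)] by linarith
    thus ?thesis using assms(5) by (simp add: mult_right_mono)
  qed
  finally show ?thesis .
qed

locale breaker_strategy =
  fixes V :: "'a set" and q :: nat and \<beta> \<delta> :: real
  assumes finite_V: "finite V" and q_pos: "0 < q"
    and p0_pos: "0 < p0 \<beta> \<delta>" and p0_less_1: "p0 \<beta> \<delta> < 1"
    and mu_gt_1: "1 < mu \<beta> \<delta> (card V) q"
    and ln_mu_small: "4 * ln (mu \<beta> \<delta> (card V) q) \<le> 1 - p0 \<beta> \<delta>"
begin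

abbreviation "ln_mu \<equiv> ln (mu \<beta> \<delta> (card V) q)"
abbreviation "vpot \<equiv> pot V q \<beta> \<delta>"
abbreviation "epot \<equiv> edge_pot V q \<beta> \<delta>"
abbreviation "vdeficit \<equiv> deficit V q \<beta> \<delta>"

definition rate :: real where
  "rate = ln_mu / q"

definition total_pot :: "'a position \<Rightarrow> real" where
  "total_pot P = (\<Sum>v\<in>V. vpot P v)"

definition max_pot :: "'a position \<Rightarrow> real" where
  "max_pot P = Max (insert 0 (epot P ` unclaimed V P))"

definition game_pot :: "'a position \<Rightarrow> real" where
  "game_pot P = total_pot P + ln_mu * max_pot P"

lemma rate_pos: "0 < rate"
  using mu_gt_1 q_pos by (simp add: rate_def)

lemma ln_mu_eq: "ln_mu = q * rate"
  using q_pos by (simp add: rate_def)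

lemma vpot_nonneg: "0 \<le> vpot P v"
  by (simp add: pot_def)

lemma vpot_eq:
  assumes "legal V P" "v \<in> V"
  shows "vpot P v = (if open_vertex V P v then exp (rate * vdeficit P v) else 0)"
  using deg_sum_eq_iff_not_open[OF finite_V assms] mu_gt_1
  by (auto simp: pot_def powr_def rate_def mult.commute)

lemma vpot_le_exp_mult:
  assumes "legal V P" "legal V P'" "unclaimed V P' \<subseteq> unclaimed V P" "v \<in> V"
    and "open_vertex V P' v \<Longrightarrow> vdeficit P' v \<le> vdeficit P v + c"
  shows "vpot P' v \<le> exp (rate * c) * vpot P v"
proof (cases "open_vertex V P' v")
  case True
  hence "open_vertex V P v" using assms(3) by (rule open_vertex_mono)
  moreover have "rate * vdeficit P' v \<le> rate * c + rate * vdeficit P v"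
    using assms(5)[OF True] rate_pos by (simp add: distrib_left[symmetric])
  ultimately show ?thesis
    using True assms(1,2,4) by (simp add: vpot_eq exp_add[symmetric])
next
  case False
  thus ?thesis using assms(2,4) by (simp add: vpot_eq vpot_nonneg)
qed

lemma epot_nonneg: "0 \<le> epot P e"
  by (simp add: edge_pot_def sum_nonneg vpot_nonneg)

lemma max_pot_nonneg: "0 \<le> max_pot P"
  unfolding max_pot_def using finite_unclaimed[OF finite_V] by (intro Max_ge) auto

lemma epot_le_max_pot: "e \<in> unclaimed V P \<Longrightarrow> epot P e \<le> max_pot P"
  unfolding max_pot_def using finite_unclaimed[OF finite_V] by (intro Max_ge) auto

lemma max_pot_le:
  assumes "0 \<le> c" "\<And>e. e \<in> unclaimed V P \<Longrightarrow> epot P e \<le> c"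
  shows "max_pot P \<le> c"
  unfolding max_pot_def using finite_unclaimed[OF finite_V] assms by (subst Max_le_iff) auto

lemma vpot_le_game_pot:
  assumes "v \<in> V"
  shows "vpot P v \<le> game_pot P"
proof -
  have "vpot P v \<le> total_pot P"
    unfolding total_pot_def using finite_V assms vpot_nonneg by (intro member_le_sum) auto
  thus ?thesis using mu_gt_1 max_pot_nonneg by (simp add: game_pot_def add_increasing2)
qed

lemma max_pot_le_mult:
  assumes "unclaimed V P' \<subseteq> unclaimed V P" "0 \<le> c"
    and "\<And>v. v \<in> V \<Longrightarrow> vpot P' v \<le> c * vpot P v"
  shows "max_pot P' \<le> c * max_pot P"
proof (rule max_pot_le)
  show "0 \<le> c * max_pot P" using assms(2) max_pot_nonneg by simp
  fix e assume unclaimed: "e \<in> unclaimed V P'"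
  have "epot P' e \<le> (\<Sum>x\<in>e. c * vpot P x)"
    unfolding edge_pot_def using unclaimed_subset[OF unclaimed] assms(3) by (intro sum_mono) auto
  also have "\<dots> = c * epot P e" by (simp add: edge_pot_def sum_distrib_left)
  also have "\<dots> \<le> c * max_pot P"
    using unclaimed assms(1,2) by (intro mult_left_mono epot_le_max_pot) auto
  finally show "epot P' e \<le> c * max_pot P" .
qed

lemma total_pot_le_scale_edge:
  assumes "e \<subseteq> V" "\<And>v. v \<in> e \<Longrightarrow> vpot P' v \<le> c * vpot P v"
    and "\<And>v. v \<in> V - e \<Longrightarrow> vpot P' v \<le> vpot P v"
  shows "total_pot P' \<le> total_pot P + (c - 1) * epot P e"
proof -
  have split: "total_pot R = sum (vpot R) (V - e) + sum (vpot R) e" for R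
    unfolding total_pot_def using assms(1) finite_V by (rule sum.subset_diff)
  have "total_pot P' \<le> sum (vpot P) (V - e) + (\<Sum>v\<in>e. c * vpot P v)"
    unfolding split[of P'] using assms(2,3) by (intro add_mono sum_mono) auto
  also have "\<dots> = total_pot P + (c - 1) * epot P e"
    by (simp add: split[of P] edge_pot_def sum_distrib_left[symmetric] algebra_simps)
  finally show ?thesis .
qed

lemma vdeficit_breaker_extends:
  assumes "breaker_extends V P P'"
  shows "vdeficit P' v = vdeficit P v - (real (deg_B P' v) - real (deg_B P v))"
  using breaker_extends_deg_M[OF assms] by (simp add: deficit_def balanced_deg_def)

lemma vdeficit_maker_claims:
  assumes "legal V P" "e \<in> unclaimed V P"
  shows "vdeficit (maker_claims e P) v
    = vdeficit P v + (if v \<in> e then p0 \<beta> \<delta> * (real q - deg_M P v - 1 / 2) else 0)"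
  using assms
  by (simp add: deficit_def balanced_deg_def deg_B_maker_claims deg_M_maker_claims[OF finite_V])
    (simp add: field_simps)

lemma vpot_breaker_extends_le:
  assumes "legal V P" "breaker_extends V P P'" "v \<in> V"
  shows "vpot P' v \<le> vpot P v"
  using vpot_le_exp_mult[OF assms(1) breaker_extends_legal[OF assms(2,1)]
      breaker_extends_unclaimed[OF assms(2)] assms(3), of 0]
    vdeficit_breaker_extends[OF assms(2)] breaker_extends_deg_B[OF finite_V assms(1,2)]
  by simp

lemma max_pot_breaker_extends_le:
  assumes "legal V P" "breaker_extends V P P'"
  shows "max_pot P' \<le> max_pot P"
  using max_pot_le_mult[of P' P 1] breaker_extends_unclaimed[OF assms(2)]
    vpot_breaker_extends_le[OF assms] by simp

lemma total_pot_breaker_claims: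
  assumes "legal V P" "e \<in> unclaimed V P"
  shows "total_pot (breaker_claims e P) \<le> total_pot P - (1 - exp (- rate)) * epot P e"
proof -
  note extends = breaker_extends_breaker_claims[OF assms(2)]
  have "vpot (breaker_claims e P) v \<le> exp (rate * (- 1)) * vpot P v" if "v \<in> e" for v
    using that unclaimed_subset[OF assms(2)] vdeficit_breaker_extends[OF extends]
      deg_B_breaker_claims[OF finite_V assms]
    by (intro vpot_le_exp_mult[OF assms(1)] breaker_extends_legal[OF extends assms(1)]
        breaker_extends_unclaimed[OF extends]) auto
  hence "total_pot (breaker_claims e P) \<le> total_pot P + (exp (- rate) - 1) * epot P e"
    using unclaimed_subset[OF assms(2)] vpot_breaker_extends_le[OF assms(1) extends]
    by (intro total_pot_le_scale_edge) auto
  thus ?thesis by (simp add: algebra_simps)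
qed

text \<open>Every free edge has at least the potential of the edges that survive the turn.\<close>

lemma free_phase_total_pot:
  assumes "breaker_turn V q \<beta> \<delta> [] k P P'" "legal V P"
  shows "total_pot P' + k * (1 - exp (- rate)) * max_pot P' \<le> total_pot P"
  using assms
proof (induction "[] :: ('a \<times> 'a) list" k P P' rule: breaker_turn.induct)
  case (stop k P)
  thus ?case by (auto simp: max_pot_def)
next
  case (free e P k P')
  have unclaimed: "e \<in> unclaimed V P" using free.hyps(1) free_choices_subset by blast
  have "max_pot P' \<le> max_pot P"
    using breaker_turn.free[OF free.hyps(1,2)] free.prems
    by (intro max_pot_breaker_extends_le breaker_turn_extends)
  also have "max_pot P \<le> epot P e"
    using free.hyps(1) epot_nonneg by (intro max_pot_le) (auto simp: free_choices_def)
  finally have "(1 - exp (- rate)) * max_pot P' \<le> (1 - exp (- rate)) * epot P e"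
    using rate_pos by (intro mult_left_mono) auto
  moreover have "total_pot P' + k * (1 - exp (- rate)) * max_pot P'
      \<le> total_pot (breaker_claims e P)"
    using free.hyps(3) breaker_extends_legal[OF breaker_extends_breaker_claims[OF unclaimed]]
      free.prems by simp
  ultimately show ?case
    using total_pot_breaker_claims[OF free.prems unclaimed] by (simp add: algebra_simps)
qed

text \<open>The closing edges at \<open>x\<close> make up for the Maker-degree of \<open>y\<close>, because \<open>p\<^sub>0 \<le> 1\<close>.\<close>

lemma closing_phase_vdeficit:
  assumes "legal V P" "{x, y} \<in> unclaimed V P" "breaker_extends V (maker_claims {x, y} P) P'"
    and "deg_B P x + deg_M P y \<le> deg_B P' x"
  shows "vdeficit P' x \<le> vdeficit P x + p0 \<beta> \<delta> * (real q - deg_M P x - deg_M P y)"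
proof -
  have "p0 \<beta> \<delta> * deg_M P y \<le> deg_M P y"
    using p0_pos p0_less_1 by (simp add: mult_left_le_one_le)
  moreover have "vdeficit P' x
      = vdeficit P x + p0 \<beta> \<delta> * (real q - deg_M P x - 1 / 2) - (real (deg_B P' x) - deg_B P x)"
    using vdeficit_breaker_extends[OF assms(3)] vdeficit_maker_claims[OF assms(1,2)]
    by (simp add: deg_B_maker_claims)
  ultimately show ?thesis using assms(4) p0_pos by (simp add: algebra_simps)
qed

lemma closing_phase_vpot:
  fixes P :: "'a position" and u v :: 'a
  defines "f \<equiv> q - (deg_M P u + deg_M P v)"
  assumes "legal V P" "{u, v} \<in> unclaimed V P" "closing_tasks P u v ts"
    and "deg_M P u + deg_M P v \<le> q" "breaker_turn V q \<beta> \<delta> ts q (maker_claims {u, v} P) P'"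
  obtains P\<^sub>1 where "legal V P\<^sub>1" "unclaimed V P\<^sub>1 \<subseteq> unclaimed V P" "breaker_turn V q \<beta> \<delta> [] f P\<^sub>1 P'"
    "\<And>x. x \<in> {u, v} \<Longrightarrow> vpot P\<^sub>1 x \<le> exp (rate * (p0 \<beta> \<delta> * f)) * vpot P x"
    "\<And>x. x \<in> V - {u, v} \<Longrightarrow> vpot P\<^sub>1 x \<le> vpot P x"
proof -
  note legal_maker = legal_maker_claims[OF assms(2,3)]
  obtain P\<^sub>1 where extends: "breaker_extends V (maker_claims {u, v} P) P\<^sub>1"
    and free_phase: "breaker_turn V q \<beta> \<delta> [] f P\<^sub>1 P'"
    and closed: "\<And>x y. {x, y} = {u, v} \<Longrightarrow> open_vertex V P\<^sub>1 x \<Longrightarrow>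
      deg_B P x + deg_M P y \<le> deg_B P\<^sub>1 x"
    using closing_phase_deg_B[OF finite_V assms(2-)] unfolding f_def by blast
  have legal: "legal V P\<^sub>1" using extends legal_maker by (rule breaker_extends_legal)
  have unclaimed: "unclaimed V P\<^sub>1 \<subseteq> unclaimed V P"
    using breaker_extends_unclaimed[OF extends] by (auto simp: unclaimed_maker_claims)
  note vpot_le = vpot_le_exp_mult[OF assms(2) legal unclaimed]
  have at_end: "vpot P\<^sub>1 x \<le> exp (rate * (p0 \<beta> \<delta> * f)) * vpot P x" if edge: "{x, y} = {u, v}" for x y
  proof (rule vpot_le)
    show "x \<in> V" using edge unclaimed_subset[OF assms(3)] by auto
    assume "open_vertex V P\<^sub>1 x"
    moreover have "real f = real q - deg_M P x - deg_M P y"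
      using edge assms(5) by (auto simp: f_def doubleton_eq_iff)
    ultimately show "vdeficit P\<^sub>1 x \<le> vdeficit P x + p0 \<beta> \<delta> * f"
      using closing_phase_vdeficit[of P x y P\<^sub>1] assms(2,3) extends closed[OF edge] edge by simp
  qed
  have elsewhere: "vpot P\<^sub>1 x \<le> vpot P x" if "x \<in> V - {u, v}" for x
  proof -
    have "vdeficit P\<^sub>1 x \<le> vdeficit P x"
      using that vdeficit_breaker_extends[OF extends] vdeficit_maker_claims[OF assms(2,3)]
        breaker_extends_deg_B[OF finite_V legal_maker extends] by simp
    thus ?thesis using vpot_le[of x 0] that by simp
  qed
  from that[OF legal unclaimed free_phase _ elsewhere] at_end[of u v] at_end[of v u] show ?thesis
    by (auto simp: insert_commute)
qed

lemma free_edges_outweigh_growth: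
  assumes "f \<le> q"
  shows "(1 + ln_mu) * (exp (rate * (p0 \<beta> \<delta> * f)) - 1) \<le> f * (1 - exp (- rate))"
    and "f * (1 - exp (- rate)) \<le> ln_mu"
proof -
  have f_rate_le: "f * rate \<le> ln_mu"
    unfolding ln_mu_eq using assms rate_pos by (intro mult_right_mono) auto
  have "rate * (1 - ln_mu) \<le> rate * (1 - rate)"
    using q_pos rate_pos by (intro mult_left_mono) (auto simp: ln_mu_eq)
  also have "\<dots> \<le> 1 - exp (- rate)" using rate_pos by (intro mult_one_minus_le_one_minus_exp) auto
  finally have rate_mult_le: "rate * (1 - ln_mu) \<le> 1 - exp (- rate)" .
  have "(1 + ln_mu) * (exp (p0 \<beta> \<delta> * (f * rate)) - 1) \<le> (1 - ln_mu) * (f * rate)"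
    using f_rate_le p0_pos rate_pos ln_mu_small by (intro mult_exp_minus_one_le) auto
  also have "\<dots> = f * (rate * (1 - ln_mu))" by simp
  also have "\<dots> \<le> f * (1 - exp (- rate))" using rate_mult_le by (intro mult_left_mono) auto
  finally show "(1 + ln_mu) * (exp (rate * (p0 \<beta> \<delta> * f)) - 1) \<le> f * (1 - exp (- rate))"
    by (simp add: mult_ac)
  have "f * (1 - exp (- rate)) \<le> f * rate"
    using exp_ge_add_one_self[of "- rate"] by (intro mult_left_mono) auto
  also note f_rate_le
  finally show "f * (1 - exp (- rate)) \<le> ln_mu" .
qed

theorem turn_game_pot_le:
  assumes "legal V P" "{u, v} \<in> unclaimed V P" "closing_tasks P u v ts"
    and "deg_M P u + deg_M P v \<le> q" "breaker_turn V q \<beta> \<delta> ts q (maker_claims {u, v} P) P'"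
  shows "game_pot P' \<le> game_pot P"
proof -
  define f where "f = q - (deg_M P u + deg_M P v)"
  define growth where "growth = exp (rate * (p0 \<beta> \<delta> * f))"
  have growth_ge_1: "1 \<le> growth" using rate_pos p0_pos by (simp add: growth_def)
  obtain P\<^sub>1 where legal: "legal V P\<^sub>1" and unclaimed: "unclaimed V P\<^sub>1 \<subseteq> unclaimed V P"
    and free_phase: "breaker_turn V q \<beta> \<delta> [] f P\<^sub>1 P'"
    and at_ends: "\<And>x. x \<in> {u, v} \<Longrightarrow> vpot P\<^sub>1 x \<le> growth * vpot P x"
    and elsewhere: "\<And>x. x \<in> V - {u, v} \<Longrightarrow> vpot P\<^sub>1 x \<le> vpot P x"
    using closing_phase_vpot[OF assms] unfolding f_def[symmetric] growth_def[symmetric] by blast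
  show ?thesis unfolding game_pot_def
  proof (rule turn_balance)
    have "total_pot P\<^sub>1 \<le> total_pot P + (growth - 1) * epot P {u, v}"
      using unclaimed_subset[OF assms(2)] at_ends elsewhere by (rule total_pot_le_scale_edge)
    also have "(growth - 1) * epot P {u, v} \<le> (growth - 1) * max_pot P"
      using growth_ge_1 epot_le_max_pot[OF assms(2)] by (intro mult_left_mono) auto
    finally show "total_pot P' + f * (1 - exp (- rate)) * max_pot P'
        \<le> total_pot P + (growth - 1) * max_pot P"
      using free_phase_total_pot[OF free_phase legal] by simp
    have "vpot P\<^sub>1 x \<le> growth * vpot P x" if "x \<in> V" for x
    proof (cases "x \<in> {u, v}")
      case False
      hence "vpot P\<^sub>1 x \<le> 1 * vpot P x" using elsewhere that by simp
      also have "\<dots> \<le> growth * vpot P x" using growth_ge_1 vpot_nonneg by (intro mult_right_mono)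
      finally show ?thesis .
    qed (rule at_ends)
    hence "max_pot P\<^sub>1 \<le> growth * max_pot P"
      using unclaimed growth_ge_1 by (intro max_pot_le_mult) auto
    thus "max_pot P' \<le> (1 + (growth - 1)) * max_pot P"
      using max_pot_breaker_extends_le[OF legal breaker_turn_extends[OF free_phase]] by simp
  qed (use free_edges_outweigh_growth[of f] max_pot_nonneg growth_ge_1 rate_pos
      in \<open>auto simp: growth_def f_def\<close>)
qed

end

section \<open>Large boards\<close>

lemma p0_less_1I:
  fixes \<beta> \<delta> :: real
  assumes "0 < \<beta>" "0 < \<delta>" "\<delta> < 1 - 8 / (3 * \<beta>)"
  shows "p0 \<beta> \<delta> < 1"
proof -
  have "8 < \<beta> * (1 - \<delta>) * 3" using assms by (simp add: field_simps)
  moreover from this have "\<beta> * (1 - \<delta>) * 3 < \<beta> * (1 - \<delta>) * (3 + \<delta>)"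
    using assms by (intro mult_strict_left_mono) auto
  ultimately show ?thesis by (simp add: p0_def)
qed

lemma one_plus_two_thirds_le:
  fixes \<delta> :: real
  assumes "0 \<le> \<delta>" "\<delta> < 1"
  shows "1 + 2 * \<delta> / 3 \<le> 3 / ((1 - \<delta>) * (3 + \<delta>))"
proof -
  have "(1 + 2 * \<delta> / 3) * ((1 - \<delta>) * (3 + \<delta>)) \<le> (1 + 2 * \<delta> / 3) * (3 - 2 * \<delta>)"
    using assms by (intro mult_left_mono) (auto simp: algebra_simps)
  also have "\<dots> \<le> 3" by (simp add: algebra_simps)
  finally show ?thesis using assms by (simp add: pos_le_divide_eq)
qed

locale large_board =
  fixes V :: "'a set" and q :: nat and \<beta> \<delta> :: real
  assumes finite_V: "finite V" and card_V: "2 \<le> card V"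
    and \<beta>_pos: "0 < \<beta>" and \<delta>_pos: "0 < \<delta>" and \<delta>_less: "\<delta> < 1 - 8 / (3 * \<beta>)"
    and q_ge_2: "2 \<le> q" and q_large: "18 * \<beta> < \<delta> * q" and q_square: "\<beta> * card V \<le> (real q)\<^sup>2"
    and mu_le: "mu \<beta> \<delta> (card V) q \<le> 4 / 3"
    and mu_minus_1_small: "4 * (mu \<beta> \<delta> (card V) q - 1) \<le> 1 - p0 \<beta> \<delta>"
begin

lemma \<delta>_less_1: "\<delta> < 1"
proof -
  have "0 < 8 / (3 * \<beta>)" using \<beta>_pos by simp
  thus ?thesis using \<delta>_less by linarith
qed

lemma ln_card_V_pos: "0 < ln (card V)"
  using card_V by simp

end

sublocale large_board \<subseteq> breaker_strategy
proof
  show mu_gt_1: "1 < mu \<beta> \<delta> (card V) q"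
    using \<beta>_pos \<delta>_pos q_ge_2 ln_card_V_pos by (simp add: mu_def)
  show "0 < p0 \<beta> \<delta>" using \<beta>_pos \<delta>_pos \<delta>_less_1 by (simp add: p0_def)
  show "p0 \<beta> \<delta> < 1" using \<beta>_pos \<delta>_pos \<delta>_less by (rule p0_less_1I)
  show "4 * ln (mu \<beta> \<delta> (card V) q) \<le> 1 - p0 \<beta> \<delta>"
    using ln_le_minus_one[of "mu \<beta> \<delta> (card V) q"] mu_gt_1 mu_minus_1_small by simp
qed (use finite_V q_ge_2 in auto)

context large_board
begin

abbreviation "n \<equiv> real (card V)"

definition rounded_card :: real where
  "rounded_card = (real q)\<^sup>2 / \<beta>"

lemma rounded_card_pos: "0 < rounded_card"
  using \<beta>_pos q_ge_2 by (simp add: rounded_card_def)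

lemma p0_mult_q_square: "p0 \<beta> \<delta> * (real q)\<^sup>2 = 8 / ((1 - \<delta>) * (3 + \<delta>)) * rounded_card"
  by (simp add: p0_def rounded_card_def)

lemma vdeficit_eq:
  "vdeficit P v
    = n - rounded_card + p0 \<beta> \<delta> * (real (deg_M P v) * (real q - real (deg_M P v) / 2)) - deg_B P v"
proof -
  have "p0 \<beta> \<delta> * ((real q)\<^sup>2 * (1 - \<delta>) * (3 + \<delta>) / 8) = rounded_card"
    using \<delta>_pos \<delta>_less_1 by (simp add: p0_def rounded_card_def)
  thus ?thesis by (simp add: deficit_def balanced_deg_def right_diff_distrib)
qed

lemma start_vpot_le_1:
  assumes "v \<in> V"
  shows "vpot ({}, {}) v \<le> 1"
proof -
  have "n \<le> rounded_card" using q_square \<beta>_pos by (simp add: rounded_card_def field_simps)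
  hence "vdeficit ({}, {}) v \<le> 0" by (simp add: vdeficit_eq deg_M_def deg_B_def)
  thus ?thesis
    using vpot_eq[of "({}, {})" v] assms rate_pos by (simp add: legal_def mult_nonneg_nonpos)
qed

lemma start_game_pot_le: "game_pot ({}, {}) \<le> n\<^sup>2"
proof -
  have "total_pot ({}, {}) \<le> (\<Sum>v\<in>V. 1)"
    unfolding total_pot_def using start_vpot_le_1 by (rule sum_mono)
  moreover have "max_pot ({}, {}) \<le> 2"
  proof (rule max_pot_le)
    fix e assume "e \<in> unclaimed V ({}, {})"
    then obtain x y where "e = {x, y}" "x \<in> V" "y \<in> V" "x \<noteq> y"
      by (rule unclaimed_doubletonE)
    thus "epot ({}, {}) e \<le> 2"
      using start_vpot_le_1[of x] start_vpot_le_1[of y] by (simp add: edge_pot_def)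
  qed simp
  hence "ln_mu * max_pot ({}, {}) \<le> 1 * 2"
    using ln_mu_small p0_pos max_pot_nonneg by (intro mult_mono) auto
  moreover have "n + 2 \<le> n\<^sup>2"
  proof -
    have "0 \<le> (n - 2) * (n + 1)" using card_V by simp
    thus ?thesis by (simp add: power2_eq_square algebra_simps)
  qed
  ultimately show ?thesis by (simp add: game_pot_def)
qed

lemma ln_mu_large: "4 * \<beta> * ln n \<le> \<delta> * q * ln_mu"
proof -
  define x where "x = mu \<beta> \<delta> (card V) q - 1"
  have x_bounds: "0 < x" "x \<le> 1 / 3" using mu_gt_1 mu_le by (simp_all add: x_def)
  have "2 / 3 * x \<le> x - x\<^sup>2"
    using mult_left_mono[OF x_bounds(2), of x] x_bounds(1) by (simp add: power2_eq_square)
  also have "\<dots> \<le> ln_mu"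
    using ln_one_plus_pos_lower_bound[of x] x_bounds by (simp add: x_def)
  finally have "\<delta> * q * (2 / 3 * x) \<le> \<delta> * q * ln_mu" using \<delta>_pos by (intro mult_left_mono) auto
  moreover have "\<delta> * q * (2 / 3 * x) = 4 * \<beta> * ln n"
    using \<delta>_pos q_ge_2 by (simp add: x_def mu_def)
  ultimately show ?thesis by linarith
qed

lemma vdeficit_le:
  assumes "legal V P" "v \<in> V" "open_vertex V P v" "game_pot P \<le> n\<^sup>2"
  shows "vdeficit P v \<le> \<delta> * rounded_card / 2"
proof (cases "0 \<le> vdeficit P v")
  case True
  have "exp (rate * vdeficit P v) = vpot P v" using assms(1-3) by (simp add: vpot_eq)
  also have "\<dots> \<le> n\<^sup>2" using vpot_le_game_pot[OF assms(2)] assms(4) by (rule order_trans)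
  also have "n\<^sup>2 = exp (2 * ln n)" using card_V by (simp add: exp_double)
  finally have pot_bound: "rate * vdeficit P v \<le> 2 * ln n" by simp
  have "vdeficit P v * (4 * \<beta> * ln n) \<le> vdeficit P v * (\<delta> * q * ln_mu)"
    using ln_mu_large True by (intro mult_left_mono)
  also have "\<dots> = \<delta> * (real q)\<^sup>2 * (rate * vdeficit P v)"
    by (simp add: ln_mu_eq power2_eq_square)
  also have "\<dots> \<le> \<delta> * (real q)\<^sup>2 * (2 * ln n)"
    using pot_bound \<delta>_pos by (intro mult_left_mono) auto
  finally have "vdeficit P v * (4 * \<beta>) * ln n \<le> \<delta> * (real q)\<^sup>2 * 2 * ln n" by (simp add: mult_ac)
  hence "vdeficit P v * (4 * \<beta>) \<le> \<delta> * (real q)\<^sup>2 * 2" using ln_card_V_pos by simp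
  thus ?thesis using \<beta>_pos by (simp add: rounded_card_def field_simps)
next
  case False
  hence "vdeficit P v \<le> 0" by simp
  also have "0 \<le> \<delta> * rounded_card / 2" using \<delta>_pos rounded_card_pos by simp
  finally show ?thesis .
qed

lemma vdeficit_gt:
  assumes "legal V P" "v \<in> V" "real q / 2 - 2 \<le> deg_M P v" "deg_M P v < real q / 2"
  shows "\<delta> * rounded_card / 2 < vdeficit P v"
proof -
  define m where "m = real (deg_M P v)"
  have "0 \<le> (m - (real q / 2 - 2)) * (q - (m + (real q / 2 - 2)) / 2)"
    using assms(3,4) by (intro mult_nonneg_nonneg) (auto simp: m_def)
  hence "3 / 8 * (real q)\<^sup>2 - (real q + 2) \<le> m * (q - m / 2)"
    by (simp add: power2_eq_square field_simps)
  hence "p0 \<beta> \<delta> * (3 / 8 * (real q)\<^sup>2 - (real q + 2)) \<le> p0 \<beta> \<delta> * (m * (q - m / 2))"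
    using p0_pos by (intro mult_left_mono) auto
  moreover have "p0 \<beta> \<delta> * (3 / 8 * (real q)\<^sup>2 - (real q + 2))
      = 3 / ((1 - \<delta>) * (3 + \<delta>)) * rounded_card - p0 \<beta> \<delta> * (real q + 2)"
    using p0_mult_q_square by (simp add: right_diff_distrib)
  moreover have "rounded_card + 2 / 3 * (\<delta> * rounded_card) \<le> 3 / ((1 - \<delta>) * (3 + \<delta>)) * rounded_card"
    using mult_right_mono[OF one_plus_two_thirds_le[of \<delta>], of rounded_card]
      \<delta>_pos \<delta>_less_1 rounded_card_pos
    by (simp add: distrib_right)
  moreover have "p0 \<beta> \<delta> * (real q + 2) < \<delta> * rounded_card / 6"
  proof -
    have "p0 \<beta> \<delta> * (real q + 2) \<le> 1 * (real q + 2)" using p0_less_1 by (intro mult_right_mono) auto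
    also have "\<dots> < 3 * real q" using q_ge_2 by simp
    also have "\<dots> < \<delta> * rounded_card / 6"
      using mult_strict_right_mono[OF q_large, of q] q_ge_2 \<beta>_pos
      by (simp add: rounded_card_def power2_eq_square field_simps)
    finally show ?thesis .
  qed
  moreover have "deg_B P v \<le> n" using deg_sum[OF finite_V assms(1,2)] by simp
  ultimately show ?thesis unfolding vdeficit_eq m_def[symmetric] by linarith
qed

lemma open_vertex_deg_M_less:
  assumes "legal V P" "v \<in> V" "open_vertex V P v" "game_pot P \<le> n\<^sup>2" "deg_M P v < real q / 2"
  shows "deg_M P v < real q / 2 - 2"
  using vdeficit_le[OF assms(1-4)] vdeficit_gt[OF assms(1,2) _ assms(5)] by linarith

definition safe :: "'a position \<Rightarrow> bool" where
  "safe P \<longleftrightarrow> legal V P \<and> paths_closed P \<and> (\<forall>v\<in>V. deg_M P v < real q / 2) \<and> game_pot P \<le> n\<^sup>2"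

lemma safe_start: "safe ({}, {})"
  using start_game_pot_le q_pos by (simp add: safe_def legal_def paths_closed_def deg_M_def)

lemma safe_turn:
  assumes "safe P" "{u, v} \<in> unclaimed V P" "closing_tasks P u v ts"
    and "breaker_turn V q \<beta> \<delta> ts q (maker_claims {u, v} P) P'"
  shows "safe P'"
proof -
  have legal: "legal V P" and paths: "paths_closed P" and pot: "game_pot P \<le> n\<^sup>2"
    and deg: "\<And>x. x \<in> V \<Longrightarrow> deg_M P x < real q / 2"
    using assms(1) by (auto simp: safe_def)
  note extends = breaker_turn_extends[OF assms(4)]
  have ends_small: "deg_M P x < real q / 2 - 2" if "x \<in> {u, v}" for x
    using that unclaimed_subset[OF assms(2)] assms(2) deg
    by (intro open_vertex_deg_M_less[OF legal _ _ pot]) (auto simp: open_vertex_def star_def)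
  have deg_le: "deg_M P u + deg_M P v \<le> q" using ends_small[of u] ends_small[of v] by simp
  have "legal V P'"
    using extends legal_maker_claims[OF legal assms(2)] by (rule breaker_extends_legal)
  moreover have "paths_closed P'"
    using finite_V legal paths assms(2,3) deg_le assms(4) by (rule breaker_turn_paths_closed)
  moreover have "deg_M P' x < real q / 2" if "x \<in> V" for x
    using deg[OF that] ends_small[of x] breaker_extends_deg_M[OF extends]
      deg_M_maker_claims[OF finite_V legal assms(2)] by auto
  moreover have "game_pot P' \<le> n\<^sup>2"
    using turn_game_pot_le[OF legal assms(2,3) deg_le assms(4)] pot by (rule order_trans)
  ultimately show ?thesis by (simp add: safe_def)
qed

lemma reachable_safe:
  assumes "reachable V q \<beta> \<delta> P"
  shows "safe P"
  using assms
proof (induction rule: reachable.induct)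
  case start
  show ?case by (rule safe_start)
next
  case (turn P u v ts P')
  thus ?case using safe_turn by (auto simp: closing_tasks_def)
qed

theorem reachable_breaker_wins:
  assumes "reachable V q \<beta> \<delta> P" "game_over V P"
  shows "\<not> (\<exists>v\<in>V. real (deg_M P v) \<ge> real q / 2) \<and> breaker_wins V P"
  using reachable_safe[OF assms(1)] paths_closed_no_triangle[of V P] assms(2)
  by (auto simp: safe_def breaker_wins_def not_le)

end

lemma eventually_large_board:
  fixes \<beta> \<delta> :: real
  assumes "0 < \<beta>" "0 < \<delta>" "\<delta> < 1 - 8 / (3 * \<beta>)"
  shows "\<forall>\<^sub>F n in sequentially. \<forall>V :: 'a set. finite V \<and> card V = n \<longrightarrow>
    large_board V (nat \<lceil>sqrt (\<beta> * real n)\<rceil>) \<beta> \<delta>"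
proof -
  define bias where "bias n = nat \<lceil>sqrt (\<beta> * real n)\<rceil>" for n
  define \<mu> where "\<mu> n = mu \<beta> \<delta> n (bias n)" for n
  have "filterlim (\<lambda>n. real (bias n)) at_top sequentially"
    unfolding bias_def using assms(1) by real_asymp
  hence bias_large: "\<forall>\<^sub>F n in sequentially. max 2 (18 * \<beta> / \<delta>) < bias n"
    unfolding filterlim_at_top_dense by blast
  have "\<mu> \<longlonglongrightarrow> 1"
    unfolding \<mu>_def mu_def bias_def using assms(1,2) by real_asymp
  moreover have "1 < min (4 / 3) (1 + (1 - p0 \<beta> \<delta>) / 4)" using p0_less_1I[OF assms] by simp
  ultimately have "\<forall>\<^sub>F n in sequentially. \<mu> n < min (4 / 3) (1 + (1 - p0 \<beta> \<delta>) / 4)"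
    by (rule order_tendstoD(2))
  with bias_large eventually_ge_at_top[of 2] show ?thesis
  proof eventually_elim
    case (elim n)
    have "\<beta> * n = (sqrt (\<beta> * n))\<^sup>2" using assms(1) by simp
    also have "\<dots> \<le> (real (bias n))\<^sup>2"
      unfolding bias_def using assms(1) by (intro power_mono real_nat_ceiling_ge) auto
    finally show ?case
      using elim assms unfolding bias_def[symmetric]
      by (auto intro!: large_board.intro simp: \<mu>_def field_simps)
  qed
qed

theorem theorem2p10:
  fixes \<epsilon> \<beta> \<delta> :: real
  assumes "\<epsilon> > 0"
    and "\<beta> = 8 / 3 + \<epsilon>"
    and "0 < \<delta>" and "\<delta> < 1 - 8 / (3 * \<beta>)"
  shows "\<exists>N. \<forall>n\<ge>N. \<forall>(V :: 'a set) q P.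
           finite V \<and> card V = n \<and> q = nat \<lceil>sqrt (\<beta> * real n)\<rceil> \<and>
           reachable V q \<beta> \<delta> P \<and> game_over V P \<longrightarrow>
             \<not> (\<exists>v\<in>V. real (deg_M P v) \<ge> real q / 2) \<and> breaker_wins V P"
proof -
  have "0 < \<beta>" using assms(1,2) by simp
  then obtain N where "\<And>n V. N \<le> n \<Longrightarrow> finite (V :: 'a set) \<Longrightarrow> card V = n \<Longrightarrow>
      large_board V (nat \<lceil>sqrt (\<beta> * real n)\<rceil>) \<beta> \<delta>"
    using eventually_large_board[of \<beta> \<delta>] assms(3,4) unfolding eventually_sequentially by blast
  thus ?thesis by (metis large_board.reachable_breaker_wins)
qed

end
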